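(* Let $P$ be a planar surface. If $K\in\mathrm{PC}(P)$ is compact, then $\tilde{\mathcal M}_{\rightsquigarrow}(K)$ and $\tilde{\mathcal M}_{\hookrightarrow}(K)$ are open in the immersive topology on $\tilde{\mathcal M}$. If $U\in\mathrm{PC}(P)$ is open in $P$, then $\tilde{\mathcal M}_{\not\rightsquigarrow}(U)$ and $\tilde{\mathcal M}_{\not\hookrightarrow}(U)$ are open in the immersive topology.
   Context: Let $\Delta$ be the open oriented topological $2$-disk with basepoint $x_0$. A pointed local homeomorphism is an orientation-preserving local homeomorphism $\phi:\Delta\to\mathbb R^2$ with $\phi(x_0)=\mathbf 0$. Two such maps $\phi,\psi$ are isomorphic if $\psi=\phi\circ h^{-1}$ for some orientation-preserving homeomorphism $h$ of $\Delta$ fixing $x_0$. The moduli space $\tilde{\mathcal M}$ is the set of isomorphism classes; an element $P\in\tilde{\mathcal M}$ is a planar surface, regarded as a topological open disk with basepoint $o_P$ and developing map $\mathrm{dev}_P:P\to\mathbb R^2$, an orientation-preserving local homeomorphism with $\mathrm{dev}_P(o_P)=\mathbf 0$. $\mathrm{PC}(P)$ is the set of path-connected subsets of $P$ containing $o_P$. For $A\in\mathrm{PC}(P)$, $B\in\mathrm{PC}(Q)$, an immersion $\iota:A\rightsquigarrow B$ is a continuous map with $\iota(o_P)=o_Q$ and $\mathrm{dev}_Q\circ\iota=\mathrm{dev}_P$ on $A$; $A\rightsquigarrow B$ means one exists, $A\not\rightsquigarrow B$ that none exists. An embedding is an injective immersion; $A\hookrightarrow B$, $A\not\hookrightarrow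 B$ similarly. $\overline{\mathrm{Disk}}(P)$ is the set of elements of $\mathrm{PC}(P)$ homeomorphic to a closed $2$-disk and containing $o_P$ in their interior; $\mathrm{Disk}(P)$ is the set of elements of $\mathrm{PC}(P)$ homeomorphic to an open $2$-disk. For compact $K\in\mathrm{PC}(P)$: $\tilde{\mathcal M}_{\rightsquigarrow}(K)=\{Q\in\tilde{\mathcal M}:K\rightsquigarrow Q\}$, $\tilde{\mathcal M}_{\hookrightarrow}(K)=\{Q:K\hookrightarrow Q\}$. For open $U\in\mathrm{PC}(P)$: $\tilde{\mathcal M}_{\not\rightsquigarrow}(U)=\{Q:U\not\rightsquigarrow Q\}$, $\tilde{\mathcal M}_{\not\hookrightarrow}(U)=\{Q:U\not\hookrightarrow Q\}$. The immersive topology on $\tilde{\mathcal M}$ is the coarsest topology in which $\tilde{\mathcal M}_{\rightsquigarrow}(K)$ is open for every $K\in\overline{\mathrm{Disk}}(P)$ and $\tilde{\mathcal M}_{\not\hookrightarrow}(U)$ is open for every $U\in\mathrm{Disk}(P)$, over all planar surfaces $P$. *)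

theory Defs
  imports "HOL-Analysis.Analysis"
begin

text \<open>Model: the pointed open 2-disk (Delta, x0) is the open unit disk of the complex plane
  with its standard orientation and basepoint 0; R^2 is identified with the complex plane.\<close>

definition Delta :: "complex set" where
  "Delta = ball 0 1"

definition winds_once_around :: "(real \<Rightarrow> complex) \<Rightarrow> complex \<Rightarrow> bool" where
  "winds_once_around \<gamma> p \<longleftrightarrow>
     (\<forall>t\<in>{0..1}. \<gamma> t \<noteq> p) \<and>
     (\<exists>\<theta>. continuous_on {0..1} \<theta> \<and>
          (\<forall>t\<in>{0..1}. \<gamma> t - p = of_real (cmod (\<gamma> t - p)) * exp (\<i> * of_real (\<theta> t))) \<and>
          \<theta> 1 - \<theta> 0 = 2 * pi)"

definition local_homeo_on :: "complex set \<Rightarrow> (complex \<Rightarrow> complex) \<Rightarrow> bool" where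
  "local_homeo_on S \<phi> \<longleftrightarrow>
     (\<forall>x\<in>S. \<exists>U. open U \<and> x \<in> U \<and> U \<subseteq> S \<and> open (\<phi> ` U) \<and>
              (\<exists>g. homeomorphism U (\<phi> ` U) \<phi> g))"

text \<open>Orientation-preserving: local degree +1, i.e. the image of a small positively oriented
  circle around each point (on which the map is injective) winds once positively around the image point.\<close>
definition orient_pres_local_homeo_on :: "complex set \<Rightarrow> (complex \<Rightarrow> complex) \<Rightarrow> bool" where
  "orient_pres_local_homeo_on S \<phi> \<longleftrightarrow>
     local_homeo_on S \<phi> \<and>
     (\<forall>x\<in>S. \<exists>r>0. cball x r \<subseteq> S \<and> inj_on \<phi> (cball x r) \<and>
        winds_once_around (\<lambda>t. \<phi> (x + of_real r * exp (2 * pi * \<i> * of_real t))) (\<phi> x))"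

text \<open>The moduli space, represented by all pointed orientation-preserving local homeomorphisms
  Delta -> C (a planar surface P is its developing map dev_P; its points are the points of Delta,
  its basepoint is 0).  All sets considered below are unions of isomorphism classes.\<close>
definition Mt :: "(complex \<Rightarrow> complex) set" where
  "Mt = {\<phi>. orient_pres_local_homeo_on Delta \<phi> \<and> \<phi> 0 = 0}"

definition PC :: "(complex \<Rightarrow> complex) \<Rightarrow> complex set set" where
  "PC P = {A. A \<subseteq> Delta \<and> path_connected A \<and> 0 \<in> A}"

definition immersion :: "(complex \<Rightarrow> complex) \<Rightarrow> complex set \<Rightarrow> (complex \<Rightarrow> complex)
    \<Rightarrow> complex set \<Rightarrow> (complex \<Rightarrow> complex) \<Rightarrow> bool" where
  "immersion P A Q B \<iota> \<longleftrightarrow> continuous_on A \<iota> \<and> \<iota> ` A \<subseteq> B \<and> \<iota> 0 = 0 \<and>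
      (\<forall>x\<in>A. Q (\<iota> x) = P x)"

definition embedding :: "(complex \<Rightarrow> complex) \<Rightarrow> complex set \<Rightarrow> (complex \<Rightarrow> complex)
    \<Rightarrow> complex set \<Rightarrow> (complex \<Rightarrow> complex) \<Rightarrow> bool" where
  "embedding P A Q B \<iota> \<longleftrightarrow> immersion P A Q B \<iota> \<and> inj_on \<iota> A"

definition immerses :: "(complex \<Rightarrow> complex) \<Rightarrow> complex set \<Rightarrow> (complex \<Rightarrow> complex)
    \<Rightarrow> complex set \<Rightarrow> bool" where
  "immerses P A Q B \<longleftrightarrow> (\<exists>\<iota>. immersion P A Q B \<iota>)"

definition embeds :: "(complex \<Rightarrow> complex) \<Rightarrow> complex set \<Rightarrow> (complex \<Rightarrow> complex)
    \<Rightarrow> complex set \<Rightarrow> bool" where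
  "embeds P A Q B \<longleftrightarrow> (\<exists>\<iota>. embedding P A Q B \<iota>)"

definition ClosedDisk :: "(complex \<Rightarrow> complex) \<Rightarrow> complex set set" where
  "ClosedDisk P = {A \<in> PC P. A homeomorphic cball (0::complex) 1 \<and> 0 \<in> interior A}"

definition OpenDisk :: "(complex \<Rightarrow> complex) \<Rightarrow> complex set set" where
  "OpenDisk P = {A \<in> PC P. A homeomorphic ball (0::complex) 1}"

definition M_imm :: "(complex \<Rightarrow> complex) \<Rightarrow> complex set \<Rightarrow> (complex \<Rightarrow> complex) set" where
  "M_imm P K = {Q \<in> Mt. immerses P K Q Delta}"

definition M_emb :: "(complex \<Rightarrow> complex) \<Rightarrow> complex set \<Rightarrow> (complex \<Rightarrow> complex) set" where
  "M_emb P K = {Q \<in> Mt. embeds P K Q Delta}"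

definition M_nimm :: "(complex \<Rightarrow> complex) \<Rightarrow> complex set \<Rightarrow> (complex \<Rightarrow> complex) set" where
  "M_nimm P U = {Q \<in> Mt. \<not> immerses P U Q Delta}"

definition M_nemb :: "(complex \<Rightarrow> complex) \<Rightarrow> complex set \<Rightarrow> (complex \<Rightarrow> complex) set" where
  "M_nemb P U = {Q \<in> Mt. \<not> embeds P U Q Delta}"

text \<open>Immersive topology: coarsest topology on Mt in which the listed sets are open
  (Mt itself is added to the subbasis so that the carrier is Mt; this does not change the topology).\<close>
definition immersive_topology :: "(complex \<Rightarrow> complex) topology" where
  "immersive_topology = topology_generated_by
     (insert Mt
       ({M_imm P K | P K. P \<in> Mt \<and> K \<in> ClosedDisk P} \<union>
        {M_nemb P U | P U. P \<in> Mt \<and> U \<in> OpenDisk P}))"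

end

theory Submission
  imports Defs "HOL-Complex_Analysis.Riemann_Mapping"
begin

text \<open>
  The core is a compactness statement (\<open>finitely_many_disks\<close>). Let \<open>K\<close> be a compact subset of an
  open \<open>U\<close> that immerses in every surface of a family. Some radius is valid for lifting Euclidean disks
  at all points of \<open>K\<close>, and it remains valid at all points of the image of \<open>K\<close> with its holes
  filled: at a point of a hole the largest radius can be increased as long as all nearby points admit
  it too. Moreover every point of the filled image is reached from \<open>K\<close> by a horizontal segment whose
  length is bounded by the diameter of the developed image of \<open>K\<close>. Hence the filled image is covered by
  a bounded number of disks indexed independently of the surface, and up to isomorphism there are only
  finitely many possibilities for it. So finitely many open disks \<open>W\<close> through which \<open>K\<close>
  immerses suffice to have one embedding in each member of the family.

  Openness of \<open>M_nimm\<close> follows by taking a compact part \<open>K\<close> of \<open>U\<close> that already fails to immerse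
  in \<open>Q\<close>, since then none of these \<open>W\<close> embeds in \<open>Q\<close>. For \<open>M_emb\<close> one takes for \<open>K\<close> a closed disk
  in \<open>Q\<close> and the family of those surfaces in which it immerses without embedding. The
  other two claims follow by composing immersions.
\<close>

subsection \<open>Sections of local homeomorphisms\<close>

definition section_over ::
  "complex set \<Rightarrow> (complex \<Rightarrow> complex) \<Rightarrow> complex \<Rightarrow> complex set \<Rightarrow> (complex \<Rightarrow> complex) \<Rightarrow> bool" where
  "section_over S Q p A s \<longleftrightarrow>
     continuous_on A s \<and> s ` A \<subseteq> S \<and> s (Q p) = p \<and> (\<forall>z\<in>A. Q (s z) = z)"

text \<open>For \<open>r > 0\<close> the image of such a section is an embedded Euclidean disk of
  radius \<open>r\<close> centred at \<open>p\<close>, in the flat structure pulled back by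
  \<open>Q\<close>. For \<open>r \<le> 0\<close> the ball is empty and the condition holds
  trivially.\<close>

definition has_section :: "complex set \<Rightarrow> (complex \<Rightarrow> complex) \<Rightarrow> complex \<Rightarrow> real \<Rightarrow> bool" where
  "has_section S Q p r \<longleftrightarrow> (\<exists>s. section_over S Q p (ball (Q p) r) s)"

lemma section_overD:
  assumes "section_over S Q p A s"
  shows "continuous_on A s" "s ` A \<subseteq> S" "s (Q p) = p" "\<And>z. z \<in> A \<Longrightarrow> Q (s z) = z"
  using assms by (auto simp: section_over_def)

lemma section_over_subset:
  "section_over S Q p A s \<Longrightarrow> B \<subseteq> A \<Longrightarrow> section_over S Q p B s"
  by (auto simp: section_over_def intro: continuous_on_subset)

lemma has_section_mono: "has_section S Q p r \<Longrightarrow> r' \<le> r \<Longrightarrow> has_section S Q p r'"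
  by (meson has_section_def section_over_subset subset_ball)

lemma local_homeo_on_injective:
  assumes "local_homeo_on S Q" "x \<in> S"
  obtains U where "open U" "x \<in> U" "U \<subseteq> S" "inj_on Q U" "continuous_on U Q"
proof -
  obtain U g where "open U" "x \<in> U" "U \<subseteq> S" "homeomorphism U (Q ` U) Q g"
    using assms unfolding local_homeo_on_def by blast
  then show thesis
    using that[of U] by (auto simp: homeomorphism_def intro: inj_on_inverseI)
qed

lemma local_homeo_on_continuous:
  assumes "local_homeo_on S Q"
  shows "continuous_on S Q"
proof -
  have "isCont Q x" if x: "x \<in> S" for x
    by (rule local_homeo_on_injective[OF assms x]) (simp add: continuous_on_eq_continuous_at)
  then show ?thesis
    by (simp add: continuous_at_imp_continuous_on)
qed

lemma local_homeo_on_subset: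
  assumes "local_homeo_on S Q" "open T" "T \<subseteq> S"
  shows "local_homeo_on T Q"
  unfolding local_homeo_on_def
proof
  fix x assume x: "x \<in> T"
  then have "x \<in> S" using assms by blast
  then obtain U where U: "open U" "x \<in> U" "U \<subseteq> S" "inj_on Q U" "continuous_on U Q"
    by (rule local_homeo_on_injective[OF assms(1)])
  let ?V = "U \<inter> T"
  have V: "open ?V" "continuous_on ?V Q" "inj_on Q ?V"
    using U assms(2) by (auto intro: continuous_on_subset inj_on_subset)
  have "open (Q ` ?V)"
    using invariance_of_domain V by blast
  moreover obtain g where "homeomorphism ?V (Q ` ?V) Q g"
    using invariance_of_domain_homeomorphism[OF V(1,2) _ V(3)] by auto
  ultimately show "\<exists>U. open U \<and> x \<in> U \<and> U \<subseteq> T \<and> open (Q ` U) \<and> (\<exists>g. homeomorphism U (Q ` U) Q g)"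
    using x U V by (intro exI[of _ ?V]) auto
qed

lemma local_homeo_on_has_section:
  assumes "local_homeo_on S Q" "p \<in> S"
  obtains r where "r > 0" "has_section S Q p r"
proof -
  obtain U g where U: "open U" "p \<in> U" "U \<subseteq> S" "open (Q ` U)" "homeomorphism U (Q ` U) Q g"
    using assms unfolding local_homeo_on_def by blast
  obtain r where r: "r > 0" "ball (Q p) r \<subseteq> Q ` U"
    using U by (meson imageI openE)
  have "section_over S Q p (Q ` U) g"
    using U unfolding section_over_def homeomorphism_def by auto
  then show thesis
    using r that section_over_subset by (meson has_section_def)
qed

text \<open>The coincidence set is relatively closed by continuity, and relatively open because
  \<open>Q\<close> is injective near each common value. Connectedness of \<open>A\<close> then
  spreads the agreement at \<open>a\<close>.\<close>

lemma lift_unique: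
  assumes Q: "local_homeo_on S Q" and A: "connected A"
    and f: "continuous_on A f" "f ` A \<subseteq> S" and g: "continuous_on A g" "g ` A \<subseteq> S"
    and eq: "\<And>x. x \<in> A \<Longrightarrow> Q (f x) = Q (g x)" and a: "a \<in> A" "f a = g a" and x: "x \<in> A"
  shows "f x = g x"
proof -
  let ?E = "{x \<in> A. f x = g x}"
  have "closedin (top_of_set A) ?E"
  proof -
    have "?E = A \<inter> (\<lambda>x. f x - g x) -` {0}" by auto
    then show ?thesis
      using continuous_closedin_preimage[OF continuous_on_diff[OF f(1) g(1)], of "{0}"] by simp
  qed
  moreover have "openin (top_of_set A) ?E"
  proof (subst openin_subopen, intro ballI)
    fix y assume y: "y \<in> ?E"
    then have "f y \<in> S" using f(2) by blast
    then obtain U where U: "open U" "f y \<in> U" "U \<subseteq> S" "inj_on Q U"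
      by (rule local_homeo_on_injective[OF Q])
    let ?T = "(A \<inter> f -` U) \<inter> (A \<inter> g -` U)"
    have "openin (top_of_set A) ?T"
      using U f g by (meson continuous_openin_preimage_gen openin_Int)
    moreover have "y \<in> ?T" using y U by auto
    moreover have "?T \<subseteq> ?E" using U(4) eq by (auto dest: inj_onD)
    ultimately show "\<exists>T. openin (top_of_set A) T \<and> y \<in> T \<and> T \<subseteq> ?E" by blast
  qed
  ultimately have "?E = {} \<or> ?E = A"
    using A unfolding connected_clopen by blast
  then show ?thesis using a x by blast
qed

lemma section_inj_on: "section_over S Q p A s \<Longrightarrow> inj_on s A"
  by (rule inj_on_inverseI[of A Q]) (rule section_overD(4))

lemma section_open_image:
  assumes "section_over S Q p A s" "open B" "B \<subseteq> A"
  shows "open (s ` B)"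
proof (rule invariance_of_domain)
  show "continuous_on B s" using assms section_overD(1) continuous_on_subset by blast
  show "inj_on s B" using assms section_inj_on inj_on_subset by blast
qed fact

text \<open>Convex domains meet in a connected set, so uniqueness of lifts turns a single common
  value into agreement on the whole overlap.\<close>

lemma sections_agree:
  assumes Q: "local_homeo_on S Q"
    and "section_over S Q p A s" "section_over S Q p' A' s'" "convex A" "convex A'"
    and w: "w \<in> A \<inter> A'" "s w = s' w" and z: "z \<in> A \<inter> A'"
  shows "s z = s' z"
proof (rule lift_unique[OF Q, of "A \<inter> A'" s s' w z])
  show "connected (A \<inter> A')"
    by (simp add: assms convex_Int convex_connected)
  show "continuous_on (A \<inter> A') s" "continuous_on (A \<inter> A') s'"
    using assms section_overD(1) by (meson continuous_on_subset inf_le1 inf_le2)+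
qed (use assms in \<open>auto simp: section_over_def\<close>)

lemma section_shift:
  assumes "section_over S Q p A s" "z \<in> A"
  shows "section_over S Q (s z) A s"
  using assms by (auto simp: section_over_def)

lemma has_section_shift:
  assumes "section_over S Q p (ball (Q p) r) s" "dist (Q p) z + d \<le> r" "d > 0"
  shows "has_section S Q (s z) d"
proof -
  have z: "z \<in> ball (Q p) r" using assms by auto
  then have "Q (s z) = z" using assms(1) section_overD(4) by blast
  moreover have "ball z d \<subseteq> ball (Q p) r"
  proof
    fix w assume "w \<in> ball z d"
    then show "w \<in> ball (Q p) r"
      using dist_triangle[of "Q p" w z] assms(2) by auto
  qed
  ultimately show ?thesis
    unfolding has_section_def using section_over_subset[OF section_shift[OF assms(1) z]] by auto
qed

text \<open>Convex sets through \<open>Q p\<close> intersect in connected sets through \<open>Q p\<close>, so no compatibility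
  has to be assumed.\<close>
lemma section_over_Union:
  assumes Q: "local_homeo_on S Q"
    and A: "\<And>A. A \<in> \<A> \<Longrightarrow> open A \<and> convex A \<and> Q p \<in> A \<and> (\<exists>s. section_over S Q p A s)"
    and ne: "\<A> \<noteq> {}"
  shows "\<exists>s. section_over S Q p (\<Union>\<A>) s"
proof -
  obtain \<sigma> where \<sigma>: "\<And>A. A \<in> \<A> \<Longrightarrow> section_over S Q p A (\<sigma> A)"
    using A by metis
  define s where "s z = \<sigma> (SOME A. A \<in> \<A> \<and> z \<in> A) z" for z
  have s: "s z = \<sigma> A z" if "A \<in> \<A>" "z \<in> A" for A z
  proof -
    let ?B = "SOME A. A \<in> \<A> \<and> z \<in> A"
    have B: "?B \<in> \<A> \<and> z \<in> ?B" using that by (intro someI) auto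
    show ?thesis unfolding s_def
      by (rule sections_agree[OF Q \<sigma>[of ?B] \<sigma>[of A], of "Q p"])
        (use A B that \<sigma> in \<open>auto simp: section_over_def\<close>)
  qed
  have "continuous_on (\<Union>\<A>) s"
  proof (rule continuous_at_imp_continuous_on, intro ballI)
    fix z assume "z \<in> \<Union>\<A>"
    then obtain A' where A': "A' \<in> \<A>" "z \<in> A'" by blast
    have "continuous_on A' s"
      using section_overD(1)[OF \<sigma>[OF A'(1)]] s[OF A'(1)] by (simp cong: continuous_on_cong)
    then show "isCont s z"
      using A A' continuous_on_eq_continuous_at by blast
  qed
  moreover have "s z \<in> S \<and> Q (s z) = z" if "A' \<in> \<A>" "z \<in> A'" for A' z
    using s[OF that] section_overD(2,4)[OF \<sigma>[OF that(1)]] that by auto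
  then have "s ` \<Union>\<A> \<subseteq> S" "\<forall>z\<in>\<Union>\<A>. Q (s z) = z"
    by blast+
  moreover obtain A0 where "A0 \<in> \<A>"
    using ne by blast
  then have "s (Q p) = p"
    using s[of A0 "Q p"] A[of A0] section_overD(3)[OF \<sigma>[of A0]] by simp
  ultimately show ?thesis
    by (auto simp: section_over_def)
qed

section \<open>Limits, enlargement and uniform bounds of radii\<close>

lemma has_section_limit:
  assumes Q: "local_homeo_on S Q" and m: "m > 0"
    and d: "\<And>d. 0 < d \<Longrightarrow> d < m \<Longrightarrow> has_section S Q p d"
  shows "has_section S Q p m"
proof -
  have "\<exists>s. section_over S Q p (\<Union>(ball (Q p) ` {0<..<m})) s"
  proof (rule section_over_Union[OF Q])
    show "ball (Q p) ` {0<..<m} \<noteq> {}" using m by simp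
  qed (use d in \<open>auto simp: has_section_def\<close>)
  moreover have "\<Union>(ball (Q p) ` {0<..<m}) = ball (Q p) m"
  proof -
    have "\<exists>d\<in>{0<..<m}. dist (Q p) z < d" if "dist (Q p) z < m" for z
    proof
      show "(dist (Q p) z + m) / 2 \<in> {0<..<m}" "dist (Q p) z < (dist (Q p) z + m) / 2"
        using that m add_nonneg_pos[OF zero_le_dist[of "Q p" z] m] by auto
    qed
    then show ?thesis by auto
  qed
  ultimately show ?thesis
    by (auto simp: has_section_def)
qed

text \<open>The disks of radius \<open>m\<close> about the nearby points \<open>s z\<close> lie over
  balls \<open>ball z m\<close> that together cover \<open>ball (Q p) (m + \<delta>)\<close>. The
  bound \<open>\<delta> \<le> m\<close> puts \<open>Q p\<close> into each of them, as gluing through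
  \<open>p\<close> requires.\<close>

lemma has_section_enlarge:
  assumes Q: "local_homeo_on S Q" and m: "0 < \<delta>" "\<delta> \<le> m"
    and s: "section_over S Q p (ball (Q p) m) s"
    and near: "\<And>z. dist (Q p) z < \<delta> \<Longrightarrow> has_section S Q (s z) m"
  shows "has_section S Q p (m + \<delta>)"
proof -
  let ?\<A> = "(\<lambda>z. ball z m) ` ball (Q p) \<delta>"
  have "\<exists>t. section_over S Q p (\<Union>?\<A>) t"
  proof (rule section_over_Union[OF Q])
    fix A assume "A \<in> ?\<A>"
    then obtain z where z: "A = ball z m" "dist (Q p) z < \<delta>" by auto
    have Qz: "Q (s z) = z"
      using z m s by (auto simp: section_over_def)
    obtain t where t: "section_over S Q (s z) (ball z m) t"
      using near[OF z(2)] Qz by (auto simp: has_section_def)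
    have zz: "z \<in> ball (Q p) m \<inter> ball z m" and pp: "Q p \<in> ball (Q p) m \<inter> ball z m"
      using z m by (auto simp: dist_commute)
    have "s z = t z"
      using section_overD(3)[OF t] Qz by simp
    then have "s (Q p) = t (Q p)"
      using sections_agree[OF Q s t _ _ zz _ pp] by auto
    then have "t (Q p) = p"
      using section_overD(3)[OF s] by simp
    then have "section_over S Q p A t"
      using t z by (auto simp: section_over_def)
    then show "open A \<and> convex A \<and> Q p \<in> A \<and> (\<exists>s. section_over S Q p A s)"
      using pp z by auto
  qed (use m in auto)
  moreover have "ball (Q p) (m + \<delta>) \<subseteq> \<Union>?\<A>"
  proof
    fix w assume w: "w \<in> ball (Q p) (m + \<delta>)"
    \<comment> \<open>\<open>z\<close> divides the segment from \<open>Q p\<close> to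
      \<open>w\<close> in the ratio \<open>\<delta> : m\<close>, so a length below
      \<open>m + \<delta>\<close> splits into parts below \<open>\<delta>\<close> and below
      \<open>m\<close>.\<close>
    define c where "c = \<delta> / (m + \<delta>)"
    define z where "z = Q p + of_real c * (w - Q p)"
    have c: "0 < c" "c < 1" "c * (m + \<delta>) = \<delta>" "(1 - c) * (m + \<delta>) = m"
      using m by (auto simp: c_def field_simps)
    have nw: "norm (w - Q p) < m + \<delta>"
      using w by (simp add: dist_norm norm_minus_commute)
    have "norm (z - Q p) = c * norm (w - Q p)"
      using c by (simp add: z_def norm_mult)
    then have "dist (Q p) z < \<delta>"
      using mult_strict_left_mono[OF nw c(1)] c by (simp add: dist_norm norm_minus_commute)
    moreover have "w - z = of_real (1 - c) * (w - Q p)"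
      by (simp add: z_def algebra_simps)
    then have "norm (w - z) = (1 - c) * norm (w - Q p)"
      using c by (simp add: norm_mult flip: of_real_diff)
    then have "dist z w < m"
      using mult_strict_left_mono[OF nw, of "1 - c"] c by (simp add: dist_norm norm_minus_commute)
    ultimately show "w \<in> \<Union>?\<A>" by auto
  qed
  ultimately show ?thesis
    unfolding has_section_def using section_over_subset by blast
qed

text \<open>The bound \<open>m\<close> is kept strict: \<open>m = 0\<close> yields a first common
  radius, and a positive \<open>m\<close> shows that a common radius can still be improved.\<close>

lemma has_section_uniform:
  assumes F: "compact F" and m: "m \<ge> 0"
    and r: "\<And>p. p \<in> F \<Longrightarrow> \<exists>r>m. has_section S Q p r"
  obtains r where "r > m" "\<And>p. p \<in> F \<Longrightarrow> has_section S Q p r"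
proof -
  have "\<exists>r s. r > m \<and> section_over S Q p (ball (Q p) r) s" if "p \<in> F" for p
    using r[OF that] by (auto simp: has_section_def)
  then obtain \<rho> \<sigma> where \<rho>: "\<And>p. p \<in> F \<Longrightarrow> \<rho> p > m"
    and \<sigma>: "\<And>p. p \<in> F \<Longrightarrow> section_over S Q p (ball (Q p) (\<rho> p)) (\<sigma> p)"
    by metis
  \<comment> \<open>Moving by less than \<open>(\<rho> p - m) / 2\<close> costs that much radius and
    leaves at least \<open>(\<rho> p + m) / 2\<close>, still above \<open>m\<close>.\<close>
  define O' where "O' p = \<sigma> p ` ball (Q p) ((\<rho> p - m) / 2)" for p
  have half: "ball (Q p) ((\<rho> p - m) / 2) \<subseteq> ball (Q p) (\<rho> p)" if "p \<in> F" for p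
    using \<rho>[OF that] m by (intro subset_ball) auto
  have "open (O' p)" if "p \<in> F" for p
    unfolding O'_def by (rule section_open_image[OF \<sigma>[OF that] open_ball half[OF that]])
  moreover have self: "p \<in> O' p" if "p \<in> F" for p
    unfolding O'_def
    by (rule image_eqI[of _ _ "Q p"]) (use section_overD(3)[OF \<sigma>[OF that]] \<rho>[OF that] in auto)
  ultimately obtain T where T: "T \<subseteq> F" "finite T" "F \<subseteq> (\<Union>p\<in>T. O' p)"
    by (elim compactE_image[OF F, of F O']) auto
  show thesis
  proof (cases "F = {}")
    case True
    then show ?thesis using that[of "m + 1"] by auto
  next
    case False
    then have T0: "T \<noteq> {}" using T by auto
    define r0 where "r0 = Min ((\<lambda>p. (\<rho> p + m) / 2) ` T)"
    have "r0 > m"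
      unfolding r0_def using T T0 \<rho> by (subst Min_gr_iff) (auto simp: subset_iff field_simps)
    moreover have "has_section S Q q r0" if q: "q \<in> F" for q
    proof -
      obtain p z where p: "p \<in> T" "q = \<sigma> p z" "dist (Q p) z < (\<rho> p - m) / 2"
        using T(3) q by (auto simp: O'_def)
      have "r0 \<le> (\<rho> p + m) / 2"
        unfolding r0_def using T p by (intro Min_le) auto
      moreover have "has_section S Q (\<sigma> p z) ((\<rho> p + m) / 2)"
      proof (rule has_section_shift[where p = p and r = "\<rho> p" and s = "\<sigma> p"])
        show "section_over S Q p (ball (Q p) (\<rho> p)) (\<sigma> p)" using \<sigma> p T by blast
        show "(\<rho> p + m) / 2 > 0" using \<rho>[of p] p T m by fastforce
        show "dist (Q p) z + (\<rho> p + m) / 2 \<le> \<rho> p" using p(3) by argo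
      qed
      ultimately show ?thesis using p has_section_mono by blast
    qed
    ultimately show ?thesis by (rule that)
  qed
qed

subsection \<open>Filled compact sets\<close>

lemma compact_Compl_outside:
  fixes C :: "complex set"
  assumes "compact C"
  shows "compact (- outside C)"
  using open_outside[OF compact_imp_closed[OF assms]] cobounded_outside[OF compact_imp_bounded[OF assms]]
  by (simp add: compact_eq_bounded_closed closed_def)

lemma section_nbhd_inside:
  assumes s: "section_over S Q p (ball (Q p) m) s" and C: "compact C" and p: "p \<in> inside C" and m: "m > 0"
  obtains \<delta> where "0 < \<delta>" "\<delta> \<le> m" "\<And>z. dist (Q p) z < \<delta> \<Longrightarrow> s z \<in> inside C"
proof -
  have "open (ball (Q p) m \<inter> s -` inside C)"
    using C section_overD(1)[OF s] by (intro continuous_open_preimage) (auto intro: open_inside compact_imp_closed)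
  moreover have "Q p \<in> ball (Q p) m \<inter> s -` inside C"
    using p m section_overD(3)[OF s] by simp
  ultimately obtain d where d: "d > 0" "ball (Q p) d \<subseteq> ball (Q p) m \<inter> s -` inside C"
    by (meson openE)
  show thesis
    by (rule that[of "min d m"]) (use d m in auto)
qed

text \<open>The supremum of the radii valid on all of the filled set is attained; at a point of
  \<open>inside C\<close> it is not maximal, because all nearby points admit the same radius.\<close>
lemma filled_has_section:
  assumes Q: "local_homeo_on S Q" and C: "compact C" and F: "- outside C \<subseteq> S"
    and r: "r > 0" and sec: "\<And>c. c \<in> C \<Longrightarrow> has_section S Q c r"
    and p: "p \<in> - outside C"
  shows "has_section S Q p r"
proof -
  let ?F = "- outside C"
  define E where "E = {m. 0 < m \<and> m \<le> r \<and> (\<forall>p\<in>?F. has_section S Q p m)}"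
  define m where "m = Sup E"
  have cF: "compact ?F" using C compact_Compl_outside by blast
  have "\<exists>r>0. has_section S Q p r" if "p \<in> ?F" for p
    using local_homeo_on_has_section[OF Q] F that by blast
  then obtain r0 where "r0 > 0" and r0_sec: "\<And>p. p \<in> ?F \<Longrightarrow> has_section S Q p r0"
    by (rule has_section_uniform[OF cF order.refl]) (blast intro: that)+
  then have r0: "min r0 r \<in> E"
    using r \<open>r0 > 0\<close> r0_sec has_section_mono[where r' = "min r0 r" and r = r0] by (auto simp: E_def)
  have bdd: "bdd_above E" by (auto simp: E_def bdd_above_def)
  have "0 < min r0 r" using r0 by (simp only: E_def mem_Collect_eq)
  also have "\<dots> \<le> m" unfolding m_def by (rule cSup_upper[OF r0 bdd])
  finally have "0 < m" .
  moreover have "m \<le> r"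
    unfolding m_def
  proof (rule cSup_least)
    show "E \<noteq> {}" using r0 by blast
  qed (simp add: E_def)
  ultimately have m: "0 < m" "m \<le> r" by auto
  have secm: "has_section S Q p m" if "p \<in> ?F" for p
  proof (rule has_section_limit[OF Q m(1)])
    fix d assume "d < m"
    then obtain e where "e \<in> E" "d < e"
      using less_cSup_iff[of E d] bdd r0 unfolding m_def by blast
    then show "has_section S Q p d"
      using that by (auto simp: E_def intro: has_section_mono)
  qed
  have "m = r"
  proof (rule ccontr)
    assume "m \<noteq> r"
    then have mr: "m < r" using m by simp
    have "\<exists>r'>m. has_section S Q p r'" if pF: "p \<in> ?F" for p
    proof (cases "p \<in> C")
      case True
      then show ?thesis using sec mr by blast
    next
      case False
      then have p: "p \<in> inside C" using pF by (simp add: inside_outside)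
      obtain s where s: "section_over S Q p (ball (Q p) m) s"
        using secm[OF pF] by (auto simp: has_section_def)
      obtain \<delta> where \<delta>: "0 < \<delta>" "\<delta> \<le> m" "\<And>z. dist (Q p) z < \<delta> \<Longrightarrow> s z \<in> inside C"
        using section_nbhd_inside[OF s C p m(1)] by blast
      have "has_section S Q p (m + \<delta>)"
      proof (rule has_section_enlarge[OF Q \<delta>(1,2) s])
        fix z assume "dist (Q p) z < \<delta>"
        then show "has_section S Q (s z) m"
          using \<delta>(3) by (intro secm) (simp add: inside_outside)
      qed
      then show ?thesis using \<delta>(1) by (intro exI[of _ "m + \<delta>"]) simp
    qed
    then obtain r' where "r' > m" and "\<And>p. p \<in> ?F \<Longrightarrow> has_section S Q p r'"
      by (rule has_section_uniform[OF cF less_imp_le[OF m(1)]]) (blast intro: that)+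
    then have "min r' r \<in> E" "min r' r > m"
      using m mr has_section_mono[where r' = "min r' r" and r = r'] by (auto simp: E_def)
    then show False
      using cSup_upper[OF _ bdd] unfolding m_def by fastforce
  qed
  then show ?thesis using secm p by blast
qed

text \<open>A maximum principle: \<open>Q\<close> is open, so a nonzero linear functional of
  \<open>Q\<close> cannot peak in a hole of \<open>C\<close>. It is applied with
  \<open>u = 1\<close> and \<open>u = -1\<close> to bound real parts from both sides.\<close>

lemma filled_max:
  assumes Q: "local_homeo_on S Q" and C: "compact C" and F: "- outside C \<subseteq> S"
    and u: "u \<noteq> 0" and p: "p \<in> - outside C"
  obtains c where "c \<in> C" "Re (u * Q p) \<le> Re (u * Q c)"
proof -
  let ?F = "- outside C"
  have "continuous_on ?F (\<lambda>x. Re (u * Q x))"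
    using local_homeo_on_continuous[OF Q] F
    by (intro continuous_intros) (auto intro: continuous_on_subset)
  then obtain q where q: "q \<in> ?F" "\<And>x. x \<in> ?F \<Longrightarrow> Re (u * Q x) \<le> Re (u * Q q)"
    using continuous_attains_sup[OF compact_Compl_outside[OF C]] p by blast
  have "q \<in> C"
  proof (rule ccontr)
    assume "q \<notin> C"
    then have qi: "q \<in> inside C" using q by (simp add: inside_outside)
    have "q \<in> S" using q F by blast
    then obtain r s where r: "r > 0" and s: "section_over S Q q (ball (Q q) r) s"
      using local_homeo_on_has_section[OF Q] by (metis has_section_def)
    obtain \<delta> where \<delta>: "0 < \<delta>" "\<delta> \<le> r" "\<And>z. dist (Q q) z < \<delta> \<Longrightarrow> s z \<in> inside C"
      using section_nbhd_inside[OF s C qi r] by blast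
    \<comment> \<open>The displacement has length \<open>\<delta> / 2\<close> and points along the
      conjugate of \<open>u\<close>, so it raises the functional by
      \<open>\<delta> / 2 * norm u\<close>.\<close>
    define z where "z = Q q + of_real (\<delta> / 2 * norm u) / u"
    have dz: "dist (Q q) z < \<delta>"
      using u \<delta> by (simp add: z_def dist_norm norm_divide norm_mult)
    have "Q (s z) = z"
      using section_overD(4)[OF s] dz \<delta> by auto
    then have "Re (u * Q (s z)) = Re (u * Q q) + \<delta> / 2 * norm u"
      using u by (simp add: z_def distrib_left)
    moreover have "s z \<in> ?F" using \<delta>(3)[OF dz] by (simp add: inside_outside)
    ultimately show False
      using q(2)[of "s z"] \<delta>(1) u by (simp add: mult_le_0_iff)
  qed
  then show thesis using that q p by blast
qed

text \<open>\<open>W\<close> is the component containing \<open>K\<close> of the complement of the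
  closure of \<open>outside C\<close>, a closure that misses \<open>interior C\<close>. The
  complement of \<open>W\<close> is connected and unbounded, so \<open>W\<close> is simply connected
  and the Riemann mapping theorem makes it a disk.\<close>

lemma open_disk_in_filled:
  fixes C :: "complex set"
  assumes C: "compact C" and K: "connected K" "K \<subseteq> interior C" "K \<noteq> {}"
  obtains W where "open W" "connected W" "W homeomorphic ball (0::complex) 1" "K \<subseteq> W" "W \<subseteq> - outside C"
proof -
  obtain x where x: "x \<in> K" using K by blast
  let ?Z = "closure (outside C)"
  have "outside C \<subseteq> - C" by (auto simp: outside_def)
  then have "?Z \<subseteq> - interior C"
    by (metis closure_complement closure_mono)
  then have KZ: "K \<subseteq> - ?Z" using K by blast
  define W where "W = connected_component_set (- ?Z) x"
  have W: "open W" "connected W" "W \<in> components (- ?Z)"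
    using x KZ by (auto simp: W_def components_def open_Compl intro: open_connected_component)
  have "connected ?Z"
    using connected_outside[OF compact_imp_bounded[OF C]] connected_imp_connected_closure by simp
  then have "connected (- W)"
    using W component_complement_connected by blast
  moreover have "\<not> bounded (- W)"
  proof
    assume "bounded (- W)"
    moreover have "outside C \<subseteq> - W"
      using W(3) in_components_subset closure_subset by blast
    ultimately show False
      using unbounded_outside[OF compact_imp_bounded[OF C]] bounded_subset by blast
  qed
  ultimately have "simply_connected W"
    using W by (metis bounded_empty components_eq_sing_iff empty_iff insert_iff simply_connected_eq_unbounded_complement_components)
  moreover have KW: "K \<subseteq> W"
    unfolding W_def using connected_component_maximal[OF x K(1) KZ] .
  ultimately have "W homeomorphic ball (0::complex) 1"
    using W simply_connected_eq_homeomorphic_to_disc x by blast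
  moreover have "W \<subseteq> - outside C"
    using W(3) in_components_subset closure_subset by blast
  ultimately show thesis using W KW that by blast
qed

subsection \<open>Covering a filled set by finitely many patches\<close>

text \<open>For a local homeomorphism \<open>Q\<close>, uniqueness of lifts makes the values on the
  ball independent of the choice. The radius is half of the radius \<open>4 * e\<close> later
  available on the filled set, which leaves room to compare patches with nearby centres.\<close>

definition patch :: "(complex \<Rightarrow> complex) \<Rightarrow> real \<Rightarrow> complex \<Rightarrow> complex \<Rightarrow> complex" where
  "patch Q e p = (SOME s. section_over Delta Q p (ball (Q p) (2 * e)) s)"

text \<open>Each step goes left by \<open>e / 2\<close> in the developed picture, so a valid walk
  ends over a point determined by the developed start and the number of steps. The recursion runs
  even where no patch exists; validity is therefore tracked separately.\<close>

primrec walk :: "(complex \<Rightarrow> complex) \<Rightarrow> real \<Rightarrow> complex \<Rightarrow> nat \<Rightarrow> complex" where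
  "walk Q e p 0 = p"
| "walk Q e p (Suc k) = patch Q e (walk Q e p k) (Q (walk Q e p k) - of_real (e / 2))"

lemma section_over_patch:
  "has_section Delta Q p (2 * e) \<Longrightarrow> section_over Delta Q p (ball (Q p) (2 * e)) (patch Q e p)"
  unfolding patch_def has_section_def
  by (rule someI_ex[of "section_over Delta Q p (ball (Q p) (2 * e))"])

text \<open>Induction on the distance of \<open>Re (Q p)\<close> from its maximum: move from \<open>p\<close> to the right by
  \<open>e / 2\<close>; either this leaves the filled set through \<open>C\<close>, or the induction hypothesis applies to
  the point reached, and the walk found there is continued by one step to the left.\<close>
lemma walk_covers:
  assumes Q: "local_homeo_on Delta Q" and e: "e > 0" and C: "compact C" and F: "- outside C \<subseteq> Delta"
    and sec: "\<And>p. p \<in> - outside C \<Longrightarrow> has_section Delta Q p (4 * e)"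
    and net: "\<And>c. c \<in> C \<Longrightarrow> \<exists>b\<in>B. has_section Delta Q b (2 * e) \<and> dist (Q b) (Q c) < e / 2 \<and> patch Q e b (Q c) = c"
    and M: "\<And>c. c \<in> C \<Longrightarrow> Re (Q c) \<le> M"
    and p: "p \<in> - outside C" "M - real n * (e / 2) < Re (Q p)"
  shows "\<exists>b\<in>B. \<exists>k\<le>n. has_section Delta Q (walk Q e b k) (2 * e) \<and>
    Q (walk Q e b k) = Q b - of_real (real k * (e / 2)) \<and>
    dist (Q (walk Q e b k)) (Q p) < e \<and> patch Q e (walk Q e b k) (Q p) = p"
  using p
proof (induction n arbitrary: p)
  case 0
  \<comment> \<open>This case is vacuous: the assumption puts \<open>Re (Q p)\<close> above
    \<open>M\<close>, yet real parts over the filled set are bounded by those over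
    \<open>C\<close>.\<close>
  obtain c where "c \<in> C" "Re (1 * Q p) \<le> Re (1 * Q c)"
    using filled_max[OF Q C F _ 0(1), of 1] by auto
  then show ?case using M 0 by fastforce
next
  case (Suc n)
  obtain s where s: "section_over Delta Q p (ball (Q p) (4 * e)) s"
    using sec[OF Suc.prems(1)] by (auto simp: has_section_def)
  have Qs: "Q (s z) = z" if "dist (Q p) z < 4 * e" for z
    using section_overD(4)[OF s] that by auto
  define z where "z = Q p + of_real (e / 2)"
  have dz: "dist (Q p) z = e / 2"
    using e by (simp add: z_def dist_norm)
  show ?case
  proof (cases "s z \<in> - outside C")
    case True
    have "M - real n * (e / 2) < Re (Q (s z))"
      using Suc.prems(2) Qs[of z] dz e by (simp add: z_def algebra_simps add_divide_distrib)
    then obtain b k where b: "b \<in> B" and k: "k \<le> n"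
      and h: "has_section Delta Q (walk Q e b k) (2 * e)"
        "Q (walk Q e b k) = Q b - of_real (real k * (e / 2))"
        "dist (Q (walk Q e b k)) (Q (s z)) < e" "patch Q e (walk Q e b k) (Q (s z)) = s z"
      using Suc.IH[OF True] by blast
    let ?w = "walk Q e b k" and ?w' = "walk Q e b (Suc k)"
    let ?c = "Q ?w" and ?c' = "Q ?w - of_real (e / 2)"
    have Qz: "Q (s z) = z" using Qs dz e by simp
    note pw = section_over_patch[OF h(1)]
    have d1: "dist (Q p) ?c < 2 * e" "dist ?c z < e"
      using dist_triangle[of "Q p" ?c z] dz h(3) Qz e by (auto simp: dist_commute)
    \<comment> \<open>Both points move left by the same vector, so the error stays below
      \<open>e\<close> however long the walk is.\<close>
    have "?c' - Q p = ?c - z" by (simp add: z_def)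
    then have d2: "dist ?c' (Q p) < e"
      using d1(2) unfolding dist_norm by metis
    have d3: "dist ?c ?c' = e / 2"
      using e by (simp add: dist_norm)
    have agree: "patch Q e ?w y = s y" if "dist ?c y < 2 * e" "dist (Q p) y < 4 * e" for y
      by (rule sections_agree[OF Q pw s, of z]) (use that d1 dz e h(4) Qz in auto)
    have w': "?w' = s ?c'"
      using agree[of ?c'] d2 d3 e by (simp add: dist_commute)
    then have Qw': "Q ?w' = ?c'"
      using Qs[of ?c'] d2 e by (simp add: dist_commute)
    have h': "has_section Delta Q ?w' (2 * e)"
      unfolding w' using s d2 e by (intro has_section_shift[OF s]) (auto simp: dist_commute)
    have "patch Q e ?w' (Q p) = s (Q p)"
    proof (rule sections_agree[OF Q section_over_patch[OF h'] s, of ?c'])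
      show "patch Q e ?w' ?c' = s ?c'"
        using section_overD(3)[OF section_over_patch[OF h']] w' Qw' by simp
    qed (use d2 Qw' e in \<open>auto simp: dist_commute\<close>)
    then have "patch Q e ?w' (Q p) = p" using section_overD(3)[OF s] by simp
    moreover have "Q ?w' = Q b - of_real (real (Suc k) * (e / 2))"
      using Qw' unfolding h(2) by (simp add: algebra_simps add_divide_distrib del: walk.simps)
    ultimately show ?thesis
      using b k h' d2 Qw' by (intro bexI[of _ b] exI[of _ "Suc k"]) auto
  next
    case False
    let ?L = "s ` closed_segment (Q p) z"
    have seg: "dist (Q p) y \<le> e / 2" if "y \<in> closed_segment (Q p) z" for y
      using that dz dist_in_closed_segment by (metis dist_commute)
    have "connected ?L"
    proof (rule connected_continuous_image)
      show "continuous_on (closed_segment (Q p) z) s"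
        using section_overD(1)[OF s] by (rule continuous_on_subset) (use seg e in fastforce)
    qed auto
    moreover have "p \<in> ?L"
      using section_overD(3)[OF s] by (metis ends_in_segment(1) imageI)
    moreover have "s z \<in> ?L" by auto
    \<comment> \<open>The lifted segment is connected and runs from the filled set to a point of
      \<open>outside C\<close>, hence it meets \<open>C\<close>.\<close>
    ultimately have "C \<inter> ?L \<noteq> {}"
      using inside_outside_intersect_connected[of ?L C] Suc.prems(1) False
      by (metis ComplI Int_iff Un_iff double_compl empty_iff union_with_inside)
    then obtain y where y: "y \<in> closed_segment (Q p) z" "s y \<in> C" by blast
    then have dy: "dist (Q p) y \<le> e / 2" using seg by blast
    then have Qy: "Q (s y) = y" using Qs e by simp
    obtain b where b: "b \<in> B" "has_section Delta Q b (2 * e)" "dist (Q b) y < e / 2"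
      "patch Q e b y = s y"
      using net[OF y(2)] Qy by auto
    have db: "dist (Q b) (Q p) < e"
      using dist_triangle[of "Q b" "Q p" y] dy b(3) by (simp add: dist_commute)
    have "patch Q e b (Q p) = s (Q p)"
      by (rule sections_agree[OF Q section_over_patch[OF b(2)] s, of y]) (use b dy db e in auto)
    then have "patch Q e b (Q p) = p" using section_overD(3)[OF s] by simp
    then show ?thesis
      using b db by (intro bexI[of _ b] exI[of _ 0]) auto
  qed
qed

text \<open>Patches with the same index share the domain \<open>T i\<close>, so the map sends each
  patch of \<open>R\<close> to its partner in \<open>Q\<close> over the same coordinates. The
  forward half of \<open>rel\<close> makes this well defined, the backward half makes it
  injective.\<close>

lemma embeds_if_same_pattern:
  assumes R: "local_homeo_on Delta R" and Q: "local_homeo_on Delta Q"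
    and T: "\<And>i. i \<in> I \<Longrightarrow> open (T i) \<and> convex (T i)"
    and s: "\<And>i. i \<in> I \<Longrightarrow> section_over Delta R (p i) (T i) (s i)"
    and t: "\<And>i. i \<in> I \<Longrightarrow> section_over Delta Q (q i) (T i) (t i)"
    and rel: "\<And>i j. i \<in> I \<Longrightarrow> j \<in> I \<Longrightarrow>
      (\<exists>z\<in>T i \<inter> T j. s i z = s j z) \<longleftrightarrow> (\<exists>z\<in>T i \<inter> T j. t i z = t j z)"
    and base: "b \<in> I" "0 \<in> T b" "s b 0 = 0" "t b 0 = 0"
  shows "embeds R (\<Union>i\<in>I. s i ` T i) Q Delta"
proof -
  let ?W = "\<Union>i\<in>I. s i ` T i"
  define g where "g x = t (SOME i. i \<in> I \<and> x \<in> s i ` T i) (R x)" for x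
  have Rs: "R (s i z) = z" and Qt: "Q (t i z) = z" if "i \<in> I" "z \<in> T i" for i z
    using s t that section_overD(4) by metis+
  have s_eq: "s i z = s j z" if "i \<in> I" "j \<in> I" "z \<in> T i \<inter> T j" "w \<in> T i \<inter> T j" "s i w = s j w" for i j z w
    by (rule sections_agree[OF R s[OF that(1)] s[OF that(2)] _ _ that(4,5,3)]) (use that T in auto)
  have t_eq: "t i z = t j z" if "i \<in> I" "j \<in> I" "z \<in> T i \<inter> T j" "w \<in> T i \<inter> T j" "t i w = t j w" for i j z w
    by (rule sections_agree[OF Q t[OF that(1)] t[OF that(2)] _ _ that(4,5,3)]) (use that T in auto)
  have g: "g (s i z) = t i z" if i: "i \<in> I" "z \<in> T i" for i z
  proof -
    define j where "j = (SOME j. j \<in> I \<and> s i z \<in> s j ` T j)"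
    have j: "j \<in> I \<and> s i z \<in> s j ` T j"
      unfolding j_def by (rule someI[of _ i]) (use i in auto)
    then obtain w where w: "w \<in> T j" "s i z = s j w" by blast
    then have "w = z" using Rs i j by metis
    then have "\<exists>w\<in>T j \<inter> T i. t j w = t i w"
      using rel[OF i(1), of j] i j w by (metis IntI Int_commute)
    then have "t j z = t i z"
      using t_eq[of j i z] i j w \<open>w = z\<close> by blast
    then show ?thesis
      using Rs[OF i] by (simp add: g_def flip: j_def)
  qed
  have "continuous_on ?W g"
  proof (rule continuous_at_imp_continuous_on, intro ballI)
    fix x assume "x \<in> ?W"
    then obtain i where i: "i \<in> I" "x \<in> s i ` T i" by blast
    have op: "open (s i ` T i)"
      using section_open_image[OF s[OF i(1)]] T i by blast
    have "R ` s i ` T i = T i"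
      using Rs[OF i(1)] by force
    moreover have "continuous_on (s i ` T i) R"
      using local_homeo_on_continuous[OF R] section_overD(2)[OF s[OF i(1)]] continuous_on_subset by blast
    ultimately have "continuous_on (s i ` T i) (t i \<circ> R)"
      using section_overD(1)[OF t[OF i(1)]] by (intro continuous_on_compose) auto
    moreover have "g y = (t i \<circ> R) y" if "y \<in> s i ` T i" for y
      using that g Rs i by auto
    ultimately have "continuous_on (s i ` T i) g"
      by (simp cong: continuous_on_cong)
    then show "isCont g x"
      using op i continuous_on_eq_continuous_at by blast
  qed
  moreover have "g ` ?W \<subseteq> Delta" "\<forall>x\<in>?W. Q (g x) = R x"
    using g Rs Qt section_overD(2)[OF t] by (auto simp: image_subset_iff)
  moreover have "g 0 = 0"
    using g[of b 0] base by simp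
  moreover have "inj_on g ?W"
  proof (rule inj_onI)
    fix x y assume "x \<in> ?W" "y \<in> ?W" and gxy: "g x = g y"
    then obtain i z j w where i: "i \<in> I" "z \<in> T i" "x = s i z" and j: "j \<in> I" "w \<in> T j" "y = s j w"
      by blast
    have tt: "t i z = t j w" using gxy g i j by simp
    then have "z = w" using Qt i j by metis
    then have "\<exists>w\<in>T i \<inter> T j. s i w = s j w"
      using rel[of i j] tt i j by blast
    then show "x = y"
      using s_eq[of i j z] i j \<open>z = w\<close> by blast
  qed
  ultimately show ?thesis
    by (auto simp: embeds_def embedding_def immersion_def)
qed

subsection \<open>Immersions\<close>

lemma immersionD:
  assumes "immersion P A Q B \<iota>"
  shows "continuous_on A \<iota>" "\<iota> ` A \<subseteq> B" "\<iota> 0 = 0" "\<And>x. x \<in> A \<Longrightarrow> Q (\<iota> x) = P x"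
  using assms by (auto simp: immersion_def)

lemma MtD:
  assumes "P \<in> Mt"
  shows "local_homeo_on Delta P" "P 0 = 0"
  using assms by (auto simp: Mt_def orient_pres_local_homeo_on_def)

lemma PCD:
  assumes "A \<in> PC P"
  shows "A \<subseteq> Delta" "path_connected A" "connected A" "0 \<in> A"
  using assms by (auto simp: PC_def path_connected_imp_connected)

lemma immersion_compose:
  assumes "immersion P A Q B \<iota>" "immersion Q B' R C \<kappa>" "B \<subseteq> B'"
  shows "immersion P A R C (\<kappa> \<circ> \<iota>)"
  unfolding immersion_def
proof (intro conjI)
  have "continuous_on (\<iota> ` A) \<kappa>"
    using assms unfolding immersion_def by (meson continuous_on_subset subset_trans)
  then show "continuous_on A (\<kappa> \<circ> \<iota>)"
    using immersionD(1)[OF assms(1)] by (intro continuous_on_compose)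
qed (use assms in \<open>auto simp: immersion_def image_subset_iff subset_iff\<close>)

lemma embedding_compose:
  assumes "embedding P A Q B \<iota>" "embedding Q B' R C \<kappa>" "B \<subseteq> B'"
  shows "embedding P A R C (\<kappa> \<circ> \<iota>)"
  unfolding embedding_def
proof
  show "immersion P A R C (\<kappa> \<circ> \<iota>)"
    using assms immersion_compose unfolding embedding_def by blast
  show "inj_on (\<kappa> \<circ> \<iota>) A"
    using assms unfolding embedding_def immersion_def by (meson comp_inj_on inj_on_subset subset_trans)
qed

lemma immersion_restrict:
  "immersion P A Q B \<iota> \<Longrightarrow> A' \<subseteq> A \<Longrightarrow> immersion P A' Q B \<iota>"
  by (auto simp: immersion_def intro: continuous_on_subset)

lemma embeds_restrict: "embeds P A Q B \<Longrightarrow> A' \<subseteq> A \<Longrightarrow> embeds P A' Q B"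
  unfolding embeds_def embedding_def using immersion_restrict inj_on_subset by blast

lemma immersion_unique:
  assumes "Q \<in> Mt" "connected A" "0 \<in> A" "immersion P A Q Delta \<iota>" "immersion P A Q Delta \<kappa>" "x \<in> A"
  shows "\<iota> x = \<kappa> x"
  using lift_unique[OF MtD(1)[OF assms(1)] assms(2), of \<iota> \<kappa> 0 x] assms(3-6)
  by (auto simp: immersion_def)

text \<open>Since \<open>Q (\<iota> x) = P x\<close>, the immersion is injective wherever
  \<open>P\<close> is, and invariance of domain applies locally.\<close>

lemma immersion_open_image:
  assumes P: "local_homeo_on U P" and \<iota>: "immersion P U Q B \<iota>"
    and O': "open O'" "O' \<subseteq> U"
  shows "open (\<iota> ` O')"
proof (subst open_subopen, intro ballI)
  fix y assume "y \<in> \<iota> ` O'"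
  then obtain x where x: "x \<in> O'" "y = \<iota> x" by blast
  then have "x \<in> U" using O' by blast
  then obtain V where V: "open V" "x \<in> V" "V \<subseteq> U" "inj_on P V" "continuous_on V P"
    by (rule local_homeo_on_injective[OF P])
  let ?V = "V \<inter> O'"
  have "inj_on \<iota> ?V"
  proof (rule inj_onI)
    fix a b assume ab: "a \<in> ?V" "b \<in> ?V" "\<iota> a = \<iota> b"
    then have "P a = P b"
      using immersionD(4)[OF \<iota>] O' by (metis IntD2 subsetD)
    then show "a = b" using ab V(4) by (auto dest: inj_onD)
  qed
  moreover have "continuous_on ?V \<iota>"
    using immersionD(1)[OF \<iota>] O' by (meson continuous_on_subset inf.coboundedI2)
  ultimately have "open (\<iota> ` ?V)"
    using V O' by (intro invariance_of_domain) auto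
  then show "\<exists>T. open T \<and> y \<in> T \<and> T \<subseteq> \<iota> ` O'"
    using x V by (intro exI[of _ "\<iota> ` ?V"]) auto
qed

text \<open>An immersion pushes disks forward without loss of radius, so radii found in
  \<open>P\<close> serve in all target surfaces at once.\<close>

lemma immersion_section:
  assumes s: "section_over U P p (ball (P p) r) s" and \<iota>: "immersion P U Q B \<iota>" and p: "p \<in> U"
  shows "section_over B Q (\<iota> p) (ball (Q (\<iota> p)) r) (\<iota> \<circ> s)"
proof -
  have "continuous_on (ball (P p) r) (\<iota> \<circ> s)"
    using section_overD(1,2)[OF s] immersionD(1)[OF \<iota>] by (meson continuous_on_compose continuous_on_subset)
  then show ?thesis
    using section_overD[OF s] immersionD[OF \<iota>] p by (auto simp: section_over_def image_subset_iff)
qed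

text \<open>The numbers \<open>e\<close> and \<open>n\<close>, the index set \<open>I\<close> and
  the domains \<open>T i\<close> are fixed from \<open>P\<close>, \<open>U\<close> and
  \<open>K\<close> before any target is considered. A target enters only through its pattern of
  valid and overlapping patches, and one representative per pattern suffices.\<close>

lemma finitely_many_disks:
  assumes P: "P \<in> Mt" and U: "U \<in> PC P" "open U" and K: "K \<in> PC P" "compact K" "K \<subseteq> U"
    and sub: "\<B> \<subseteq> {Q \<in> Mt. immerses P U Q Delta}"
  shows "\<exists>\<R> W. finite \<R> \<and> \<R> \<subseteq> \<B> \<and>
    (\<forall>R\<in>\<R>. W R \<in> OpenDisk R \<and> immerses P K R (W R)) \<and>
    (\<forall>Q\<in>\<B>. \<exists>R\<in>\<R>. embeds R (W R) Q Delta)"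
proof -
  have \<B>: "Q \<in> Mt \<and> immerses P U Q Delta" if "Q \<in> \<B>" for Q
    using sub that by blast
  have lhP: "local_homeo_on U P"
    using local_homeo_on_subset[OF MtD(1)[OF P]] U PCD(1) by blast
  obtain \<delta> where \<delta>: "\<delta> > 0" "(\<Union>x\<in>K. cball x \<delta>) \<subseteq> U"
    using compact_subset_open_imp_cball_epsilon_subset[OF K(2) U(2) K(3)] by blast
  define K2 where "K2 = (\<Union>x\<in>K. cball x \<delta>)"
  have K2: "compact K2" "K2 \<subseteq> U"
    using \<delta> K(2) compact_minkowski_sum_cball by (auto simp: K2_def)
  \<comment> \<open>\<open>K1\<close> is an open layer between \<open>K\<close> and
    \<open>K2\<close>: its image is open and so puts the image of \<open>K\<close> into the interior
    of the image of \<open>K2\<close>.\<close>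
  define K1 where "K1 = (\<Union>x\<in>K. ball x \<delta>)"
  have K1: "open K1" "K \<subseteq> K1" "K1 \<subseteq> K2" "K1 \<subseteq> U"
    unfolding K1_def K2_def
  proof -
    show sub: "(\<Union>x\<in>K. ball x \<delta>) \<subseteq> (\<Union>x\<in>K. cball x \<delta>)"
      using ball_subset_cball by blast
    then show "(\<Union>x\<in>K. ball x \<delta>) \<subseteq> U" using \<delta>(2) by blast
    show "K \<subseteq> (\<Union>x\<in>K. ball x \<delta>)" using \<delta>(1) by force
  qed blast
  have "0 \<in> K2" using K1 PCD(4)[OF K(1)] by blast
  have "\<exists>r>0. has_section U P p r" if "p \<in> K2" for p
    using local_homeo_on_has_section[OF lhP] K2 that by blast
  then obtain r0 where r0: "r0 > 0" "\<And>p. p \<in> K2 \<Longrightarrow> has_section U P p r0"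
    by (rule has_section_uniform[OF K2(1) order.refl]) (blast intro: that)+
  define e where "e = r0 / 4"
  have e: "e > 0" using r0 by (simp add: e_def)
  obtain \<sigma> where \<sigma>: "\<And>k. k \<in> K2 \<Longrightarrow> section_over U P k (ball (P k) (4 * e)) (\<sigma> k)"
    using r0(2) unfolding has_section_def e_def by simp metis
  have "\<exists>B0. B0 \<subseteq> K2 \<and> finite B0 \<and> K2 \<subseteq> (\<Union>b\<in>B0. \<sigma> b ` ball (P b) (e / 2))"
  proof (rule compactE_image[OF K2(1), of K2 "\<lambda>b. \<sigma> b ` ball (P b) (e / 2)"])
    show "open (\<sigma> b ` ball (P b) (e / 2))" if "b \<in> K2" for b
      using section_open_image[OF \<sigma>[OF that]] e by (simp add: subset_ball)
    show "K2 \<subseteq> (\<Union>b\<in>K2. \<sigma> b ` ball (P b) (e / 2))"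
    proof
      fix b assume "b \<in> K2"
      moreover have "b \<in> \<sigma> b ` ball (P b) (e / 2)"
        by (rule image_eqI[of _ _ "P b"]) (use section_overD(3)[OF \<sigma>[OF \<open>b \<in> K2\<close>]] e in auto)
      ultimately show "b \<in> (\<Union>b\<in>K2. \<sigma> b ` ball (P b) (e / 2))" by blast
    qed
  qed blast
  then obtain B0 where B0: "B0 \<subseteq> K2" "finite B0" "K2 \<subseteq> (\<Union>b\<in>B0. \<sigma> b ` ball (P b) (e / 2))"
    by blast
  \<comment> \<open>The basepoint is added so that the index \<open>(0, 0)\<close> is valid for
    every target and supplies the base patch, which lifts \<open>0\<close> to
    \<open>0\<close>.\<close>
  define B where "B = insert 0 B0"
  have B: "finite B" "B \<subseteq> K2" using B0 \<open>0 \<in> K2\<close> by (auto simp: B_def)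
  have "bounded (P ` K2)"
    using K2 local_homeo_on_continuous[OF lhP]
    by (intro compact_imp_bounded compact_continuous_image) (auto intro: continuous_on_subset)
  then obtain M where M: "\<And>k. k \<in> K2 \<Longrightarrow> norm (P k) \<le> M"
    by (auto simp: bounded_iff)
  \<comment> \<open>Developed real parts on \<open>K2\<close> lie between \<open>-M\<close> and
    \<open>M\<close>, so \<open>n\<close> steps of length \<open>e / 2\<close> cross the whole width
    \<open>2 * M\<close>.\<close>
  obtain n :: nat where n: "2 * M < real n * (e / 2)"
    using reals_Archimedean3[of "e / 2"] e by (meson half_gt_zero)
  define I where "I = B \<times> {..n}"
  have finI: "finite I" using B by (simp add: I_def)
  define ctr where "ctr i = P (fst i) - of_real (real (snd i) * (e / 2))" for i :: "complex \<times> nat"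
  define T where "T i = ball (ctr i) (2 * e)" for i
  have "\<exists>\<iota>. \<forall>Q\<in>\<B>. immersion P U Q Delta (\<iota> Q)"
    using \<B> by (intro bchoice) (auto simp: immerses_def)
  then obtain \<iota> where \<iota>: "\<And>Q. Q \<in> \<B> \<Longrightarrow> immersion P U Q Delta (\<iota> Q)"
    by blast
  have lh: "local_homeo_on Delta Q" if "Q \<in> \<B>" for Q
    using \<B> that MtD by blast
  define w where "w Q i = walk Q e (\<iota> Q (fst i)) (snd i)" for Q and i :: "complex \<times> nat"
  \<comment> \<open>The first condition makes the patch a genuine section; the second ensures that
    it lies over the common domain \<open>T i\<close>.\<close>
  define V where "V Q = {i \<in> I. has_section Delta Q (w Q i) (2 * e) \<and> Q (w Q i) = ctr i}" for Q
  define s where "s Q i = patch Q e (w Q i)" for Q i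
  \<comment> \<open>The pattern determines the surface on the union of its patches, and it takes finitely many values.\<close>
  define pat where "pat Q = (V Q, {(i, j) \<in> V Q \<times> V Q. \<exists>z\<in>T i \<inter> T j. s Q i z = s Q j z})" for Q
  have sec: "section_over Delta Q (w Q i) (T i) (s Q i)" if "i \<in> V Q" for Q i
    using that section_over_patch[of Q "w Q i" e] by (simp add: V_def s_def T_def)

  have PQ: "Q (\<iota> Q k) = P k" if "Q \<in> \<B>" "k \<in> K2" for Q k
    using immersionD(4)[OF \<iota>[OF that(1)]] that K2 by blast
  have sec4: "section_over Delta Q (\<iota> Q k) (ball (P k) (4 * e)) (\<iota> Q \<circ> \<sigma> k)" if "Q \<in> \<B>" "k \<in> K2" for Q k
    using immersion_section[OF \<sigma>[OF that(2)] \<iota>[OF that(1)]] that K2 PQ[OF that] by (metis subsetD)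
  define C where "C Q = \<iota> Q ` K2" for Q
  have C: "compact (C Q)" "- outside (C Q) \<subseteq> Delta" if "Q \<in> \<B>" for Q
  proof -
    show "compact (C Q)"
      unfolding C_def using immersionD(1)[OF \<iota>[OF that]] K2
      by (intro compact_continuous_image) (auto intro: continuous_on_subset)
    have "C Q \<subseteq> Delta"
      unfolding C_def using immersionD(2)[OF \<iota>[OF that]] K2 by blast
    \<comment> \<open>The convex disk \<open>Delta\<close> has no holes, so filling
      \<open>C Q\<close> does not leave the surface.\<close>
    then show "- outside (C Q) \<subseteq> Delta"
      using outside_subset_convex[of Delta "C Q"] by (auto simp: Delta_def)
  qed
  have filled4: "has_section Delta Q p (4 * e)" if Q: "Q \<in> \<B>" and p: "p \<in> - outside (C Q)" for Q p
  proof (rule filled_has_section[OF lh[OF Q] C[OF Q] _ _ p])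
    fix c assume "c \<in> C Q"
    then obtain k where "k \<in> K2" "c = \<iota> Q k" by (auto simp: C_def)
    then show "has_section Delta Q c (4 * e)"
      using sec4[OF Q] PQ[OF Q] unfolding has_section_def by auto
  qed (use e in auto)
  have cover: "- outside (C Q) \<subseteq> (\<Union>i\<in>V Q. s Q i ` T i)" if Q: "Q \<in> \<B>" for Q
  proof
    fix p assume p: "p \<in> - outside (C Q)"
    \<comment> \<open>The choice \<open>u = -1\<close> bounds real parts over the filled set from
      below by \<open>-M\<close>, within reach of \<open>n\<close> steps from
      \<open>M\<close>.\<close>
    obtain c where "c \<in> C Q" "Re ((-1) * Q p) \<le> Re ((-1) * Q c)"
      by (rule filled_max[OF lh[OF Q] C[OF Q] _ p, of "-1"]) auto
    moreover have "\<bar>Re (Q c)\<bar> \<le> M" if "c \<in> C Q" for c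
      using that M PQ[OF Q] abs_Re_le_cmod order_trans unfolding C_def by fastforce
    ultimately have low: "M - real n * (e / 2) < Re (Q p)" and up: "\<And>c. c \<in> C Q \<Longrightarrow> Re (Q c) \<le> M"
      using n by (fastforce simp: abs_le_iff)+
    have net: "\<exists>b\<in>\<iota> Q ` B. has_section Delta Q b (2 * e) \<and> dist (Q b) (Q c) < e / 2 \<and> patch Q e b (Q c) = c"
      if c: "c \<in> C Q" for c
    proof -
      obtain k where k: "k \<in> K2" "c = \<iota> Q k" using c by (auto simp: C_def)
      then obtain b z where b: "b \<in> B0" "k = \<sigma> b z" "dist (P b) z < e / 2" using B0(3) by auto
      then have bK: "b \<in> K2" using B0 by blast
      have z: "P k = z" using section_overD(4)[OF \<sigma>[OF bK], of z] b e by auto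
      note s4 = sec4[OF Q bK]
      have h: "has_section Delta Q (\<iota> Q b) (2 * e)"
        using s4 PQ[OF Q bK] e has_section_mono[of Delta Q "\<iota> Q b" "4 * e" "2 * e"]
        by (auto simp: has_section_def)
      have "patch Q e (\<iota> Q b) z = (\<iota> Q \<circ> \<sigma> b) z"
        by (rule sections_agree[OF lh[OF Q] section_over_patch[OF h] s4, of "P b"])
          (use section_overD(3)[OF section_over_patch[OF h]] section_overD(3)[OF s4] PQ[OF Q bK] b e in auto)
      then show ?thesis
        using b h z k PQ[OF Q bK] PQ[OF Q k(1)] by (intro bexI[of _ "\<iota> Q b"]) (auto simp: B_def)
    qed
    obtain b k where bk: "b \<in> B" "k \<le> n" "has_section Delta Q (walk Q e (\<iota> Q b) k) (2 * e)"
      "Q (walk Q e (\<iota> Q b) k) = Q (\<iota> Q b) - of_real (real k * (e / 2))"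
      "dist (Q (walk Q e (\<iota> Q b) k)) (Q p) < e" "patch Q e (walk Q e (\<iota> Q b) k) (Q p) = p"
      using walk_covers[OF lh[OF Q] e C[OF Q] filled4[OF Q] net up p low] by auto
    have bK: "b \<in> K2" using bk B by blast
    have "(b, k) \<in> V Q"
      using bk PQ[OF Q bK] by (simp add: V_def I_def w_def ctr_def)
    moreover have "Q p \<in> T (b, k)"
      using bk PQ[OF Q bK] e by (simp add: T_def ctr_def)
    moreover have "s Q (b, k) (Q p) = p"
      using bk by (simp add: s_def w_def)
    ultimately show "p \<in> (\<Union>i\<in>V Q. s Q i ` T i)" by (metis UN_iff image_eqI)
  qed

  have "\<exists>W. W \<in> OpenDisk R \<and> immerses P K R W \<and> W \<subseteq> (\<Union>i\<in>V R. s R i ` T i)" if R: "R \<in> \<B>" for R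
  proof -
    have cont: "continuous_on K (\<iota> R)"
      using immersionD(1)[OF \<iota>[OF R]] K(3) continuous_on_subset by blast
    have conn: "connected (\<iota> R ` K)"
      using cont PCD(3)[OF K(1)] by (rule connected_continuous_image)
    have "open (\<iota> R ` K1)"
      using immersion_open_image[OF lhP \<iota>[OF R]] K1 by blast
    then have "\<iota> R ` K1 \<subseteq> interior (C R)"
      unfolding C_def using K1(3) by (intro interior_maximal image_mono)
    then have int: "\<iota> R ` K \<subseteq> interior (C R)"
      using K1(2) by blast
    have ne: "0 \<in> \<iota> R ` K"
      using PCD(4)[OF K(1)] immersionD(3)[OF \<iota>[OF R]] by (metis imageI)
    obtain W where W: "open W" "connected W" "W homeomorphic ball (0::complex) 1" "\<iota> R ` K \<subseteq> W" "W \<subseteq> - outside (C R)"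
      by (rule open_disk_in_filled[OF C(1)[OF R] conn int]) (use ne in \<open>auto intro: that\<close>)
    have "path_connected W"
      using W connected_open_path_connected by blast
    then have "W \<in> OpenDisk R"
      using W ne C(2)[OF R] by (auto simp: OpenDisk_def PC_def)
    moreover have "immersion P K R W (\<iota> R)"
      using cont W(4) immersionD(3,4)[OF \<iota>[OF R]] K(3) by (auto simp: immersion_def)
    ultimately show ?thesis
      using W cover[OF R] unfolding immerses_def by blast
  qed
  then obtain W where W: "\<And>R. R \<in> \<B> \<Longrightarrow> W R \<in> OpenDisk R" "\<And>R. R \<in> \<B> \<Longrightarrow> immerses P K R (W R)"
    "\<And>R. R \<in> \<B> \<Longrightarrow> W R \<subseteq> (\<Union>i\<in>V R. s R i ` T i)"
    by metis
  have same: "embeds R (W R) Q Delta" if R: "R \<in> \<B>" and Q: "Q \<in> \<B>" and eq: "pat R = pat Q" for R Q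
  proof (rule embeds_restrict[OF _ W(3)[OF R]])
    have VV: "V R = V Q" using eq by (simp add: pat_def)
    have E: "{(i, j) \<in> V R \<times> V R. \<exists>z\<in>T i \<inter> T j. s R i z = s R j z} =
        {(i, j) \<in> V Q \<times> V Q. \<exists>z\<in>T i \<inter> T j. s Q i z = s Q j z}"
      using eq unfolding pat_def by (elim Pair_inject)
    have i0: "(0, 0) \<in> V Q' \<and> 0 \<in> T (0, 0) \<and> s Q' (0, 0) 0 = 0" if Q': "Q' \<in> \<B>" for Q'
    proof -
      have Q0: "\<iota> Q' 0 = 0" "Q' 0 = 0" "P 0 = 0"
        using immersionD(3)[OF \<iota>[OF Q']] \<B>[OF Q'] P MtD(2) by auto
      have "has_section Delta Q' 0 (2 * e)"
        using sec4[OF Q' \<open>0 \<in> K2\<close>] e Q0 has_section_mono[of Delta Q' 0 "4 * e" "2 * e"]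
        by (auto simp: has_section_def)
      then have v: "(0, 0) \<in> V Q'"
        using Q0 by (simp add: V_def I_def B_def w_def ctr_def)
      show ?thesis
        using v section_overD(3)[OF sec[OF v]] Q0 e by (simp add: T_def ctr_def w_def)
    qed
    show "embeds R (\<Union>i\<in>V R. s R i ` T i) Q Delta"
    proof (rule embeds_if_same_pattern[where t = "s Q" and b = "(0, 0)" and p = "w R" and q = "w Q"])
      show "open (T i) \<and> convex (T i)" if "i \<in> V R" for i by (simp add: T_def)
      show "section_over Delta R (w R i) (T i) (s R i)" "section_over Delta Q (w Q i) (T i) (s Q i)"
        if "i \<in> V R" for i using that sec VV by auto
      show "(\<exists>z\<in>T i \<inter> T j. s R i z = s R j z) \<longleftrightarrow> (\<exists>z\<in>T i \<inter> T j. s Q i z = s Q j z)"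
        if ij: "i \<in> V R" "j \<in> V R" for i j
      proof -
        have "(i, j) \<in> {(i, j) \<in> V R \<times> V R. \<exists>z\<in>T i \<inter> T j. s R i z = s R j z} \<longleftrightarrow>
          (i, j) \<in> {(i, j) \<in> V Q \<times> V Q. \<exists>z\<in>T i \<inter> T j. s Q i z = s Q j z}"
          using E by simp
        then show ?thesis using ij VV by simp
      qed
    qed (use i0[OF R] i0[OF Q] lh[OF R] lh[OF Q] VV in simp_all)
  qed
  have "pat ` \<B> \<subseteq> Pow I \<times> Pow (I \<times> I)"
    by (auto simp: pat_def V_def)
  then have "finite (pat ` \<B>)"
    by (rule finite_subset) (use finI in auto)
  \<comment> \<open>One surface is picked for each of the finitely many patterns.\<close>
  define \<R> where "\<R> = inv_into \<B> pat ` pat ` \<B>"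
  have \<R>: "\<R> \<subseteq> \<B>"
    unfolding \<R>_def by (auto intro: inv_into_into)
  have "\<exists>R\<in>\<R>. embeds R (W R) Q Delta" if Q: "Q \<in> \<B>" for Q
  proof (rule bexI)
    show "embeds (inv_into \<B> pat (pat Q)) (W (inv_into \<B> pat (pat Q))) Q Delta"
      by (rule same) (use Q in \<open>simp_all add: inv_into_into f_inv_into_f\<close>)
  qed (use Q in \<open>auto simp: \<R>_def\<close>)
  moreover have "finite \<R>"
    using \<open>finite (pat ` \<B>)\<close> by (simp add: \<R>_def)
  ultimately show ?thesis
    using \<R> W(1,2) by (intro exI[of _ \<R>] exI[of _ W]) blast
qed

subsection \<open>The immersive topology\<close>

lemma openin_Mt: "openin immersive_topology Mt"
  unfolding immersive_topology_def by (rule topology_generated_by_Basis) simp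

lemma openin_M_imm_ClosedDisk:
  "P \<in> Mt \<Longrightarrow> K \<in> ClosedDisk P \<Longrightarrow> openin immersive_topology (M_imm P K)"
  unfolding immersive_topology_def by (rule topology_generated_by_Basis) blast

lemma openin_M_nemb_OpenDisk:
  "P \<in> Mt \<Longrightarrow> U \<in> OpenDisk P \<Longrightarrow> openin immersive_topology (M_nemb P U)"
  unfolding immersive_topology_def by (rule topology_generated_by_Basis) blast

lemma cball_ClosedDisk:
  assumes "0 < r" "r < 1"
  shows "cball 0 r \<in> ClosedDisk Q"
  using assms homeomorphic_balls(2)[of r 1 "0::complex" "0::complex"]
  by (auto simp: ClosedDisk_def PC_def Delta_def convex_imp_path_connected)

text \<open>Compactness places a round closed disk of \<open>Q\<close> between the image of
  \<open>K\<close> and the whole surface. This reduces arbitrary compact sets to subbasic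
  ones.\<close>

lemma immersion_in_cball:
  assumes "compact K" "immersion P K Q Delta \<iota>"
  obtains r where "0 < r" "r < 1" "immersion P K Q (cball 0 r) \<iota>"
proof (cases "K = {}")
  case True
  then show thesis using assms that[of "1 / 2"] by (auto simp: immersion_def)
next
  case False
  have "continuous_on K (\<lambda>x. norm (\<iota> x))"
    using immersionD(1)[OF assms(2)] by (rule continuous_on_norm)
  then obtain x where x: "x \<in> K" "\<And>y. y \<in> K \<Longrightarrow> norm (\<iota> y) \<le> norm (\<iota> x)"
    using continuous_attains_sup[OF assms(1) False] by blast
  have "norm (\<iota> x) < 1"
    using immersionD(2)[OF assms(2)] x by (auto simp: Delta_def)
  \<comment> \<open>The lower bound \<open>1 / 2\<close> keeps the radius positive even if
    \<open>K\<close> maps to the basepoint alone.\<close>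
  then show thesis
    using that[of "max (1 / 2) (norm (\<iota> x))"] x assms(2) by (fastforce simp: immersion_def)
qed

text \<open>Each member of \<open>\<B>\<close> receives an embedding of one of finitely many disks,
  while \<open>sep\<close> forbids all of these in \<open>Q0\<close>. The conditions
  \<open>M_nemb R (W R)\<close> thus separate \<open>Q0\<close> from \<open>\<B>\<close>, and
  finiteness keeps their intersection open.\<close>

lemma separating_nbhd:
  assumes Q0: "Q0 \<in> Mt" and P: "P \<in> Mt" and U: "U \<in> PC P" "open U"
    and K: "K \<in> PC P" "compact K" "K \<subseteq> U"
    and sub: "\<B> \<subseteq> {Q \<in> Mt. immerses P U Q Delta}"
    and sep: "\<And>R W. R \<in> \<B> \<Longrightarrow> W \<in> OpenDisk R \<Longrightarrow> immerses P K R W \<Longrightarrow> \<not> embeds R W Q0 Delta"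
  obtains N where "openin immersive_topology N" "Q0 \<in> N" "N \<inter> \<B> = {}"
proof -
  obtain \<R> W where \<R>: "finite \<R>" "\<R> \<subseteq> \<B>"
    and W: "\<forall>R\<in>\<R>. W R \<in> OpenDisk R \<and> immerses P K R (W R)"
    and emb: "\<forall>Q\<in>\<B>. \<exists>R\<in>\<R>. embeds R (W R) Q Delta"
    using finitely_many_disks[OF P U K sub] by (elim exE conjE) (rule that)
  let ?N = "\<Inter>(insert Mt ((\<lambda>R. M_nemb R (W R)) ` \<R>))"
  have "openin immersive_topology ?N"
  proof (rule openin_Inter)
    fix X assume "X \<in> insert Mt ((\<lambda>R. M_nemb R (W R)) ` \<R>)"
    then show "openin immersive_topology X"
      using openin_Mt openin_M_nemb_OpenDisk W \<R>(2) sub by blast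
  qed (use \<R> in auto)
  moreover have "Q0 \<in> ?N"
    using Q0 sep W \<R>(2) by (auto simp: M_nemb_def)
  moreover have "?N \<inter> \<B> = {}"
    using emb by (auto simp: M_nemb_def)
  ultimately show thesis by (rule that)
qed

section \<open>Openness of the four families\<close>

lemma openin_M_imm:
  assumes K: "compact K"
  shows "openin immersive_topology (M_imm P K)"
proof (subst openin_subopen, intro ballI)
  fix Q assume "Q \<in> M_imm P K"
  then obtain \<iota> where Q: "Q \<in> Mt" and \<iota>: "immersion P K Q Delta \<iota>"
    by (auto simp: M_imm_def immerses_def)
  obtain r where r: "0 < r" "r < 1" "immersion P K Q (cball 0 r) \<iota>"
    by (rule immersion_in_cball[OF K \<iota>])
  \<comment> \<open>A surface that receives this disk of \<open>Q\<close> also receives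
    \<open>K\<close>, by composition.\<close>
  have "M_imm Q (cball 0 r) \<subseteq> M_imm P K"
    unfolding M_imm_def immerses_def using immersion_compose[OF r(3)] by blast
  moreover have "Q \<in> M_imm Q (cball 0 r)"
    using Q r unfolding M_imm_def immerses_def immersion_def
    by (auto simp: Delta_def intro!: exI[of _ id])
  ultimately show "\<exists>T. openin immersive_topology T \<and> Q \<in> T \<and> T \<subseteq> M_imm P K"
    using openin_M_imm_ClosedDisk[OF Q cball_ClosedDisk[OF r(1,2)]] by blast
qed

lemma openin_M_emb:
  assumes K: "compact K"
  shows "openin immersive_topology (M_emb P K)"
proof (subst openin_subopen, intro ballI)
  fix Q assume "Q \<in> M_emb P K"
  then obtain \<iota> where Q: "Q \<in> Mt" and \<iota>: "immersion P K Q Delta \<iota>" "inj_on \<iota> K"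
    by (auto simp: M_emb_def embeds_def embedding_def)
  obtain r where r: "0 < r" "r < 1" "immersion P K Q (cball 0 r) \<iota>"
    by (rule immersion_in_cball[OF K \<iota>(1)])
  \<comment> \<open>The larger radius leaves an open disk \<open>?U\<close> around the compact
    \<open>?D\<close>. Immersing \<open>?D'\<close> is a subbasic condition that forces
    \<open>?U\<close> to immerse.\<close>
  obtain t where t: "r < t" "t < 1" using r dense by blast
  let ?D = "cball 0 r" and ?U = "ball 0 t" and ?D' = "cball 0 t"
  have emb: "embedding P K Q ?D \<iota>"
    using r \<iota> by (simp add: embedding_def)
  have PC: "?D \<in> PC Q" "?U \<in> PC Q"
    using r t by (auto simp: PC_def Delta_def convex_imp_path_connected)
  have id: "immersion Q ?D Q Delta id"
    using r by (auto simp: immersion_def Delta_def)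
  define \<B> where "\<B> = {R \<in> Mt. immerses Q ?U R Delta \<and> \<not> embeds Q ?D R Delta}"
  obtain N where N: "openin immersive_topology N" "Q \<in> N" "N \<inter> \<B> = {}"
  proof (rule separating_nbhd[OF Q Q PC(2) open_ball PC(1) compact_cball, of \<B>])
    show "?D \<subseteq> ?U" using t by auto
    show "\<B> \<subseteq> {R \<in> Mt. immerses Q ?U R Delta}"
      by (auto simp: \<B>_def)
    show "\<not> embeds R W Q Delta" if R: "R \<in> \<B>" and W: "W \<in> OpenDisk R" "immerses Q ?D R W" for R W
    proof
      assume "embeds R W Q Delta"
      then obtain \<mu> where \<mu>: "immersion R W Q Delta \<mu>"
        by (auto simp: embeds_def embedding_def)
      obtain \<kappa> where \<kappa>: "immersion Q ?D R W \<kappa>" using W(2) by (auto simp: immerses_def)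
      \<comment> \<open>Uniqueness identifies the passage through \<open>W\<close> with the
        inclusion. So \<open>\<kappa>\<close> has a left inverse and embeds \<open>?D\<close>,
        contrary to the choice of \<open>\<B>\<close>.\<close>
      have "(\<mu> \<circ> \<kappa>) x = id x" if "x \<in> ?D" for x
        by (rule immersion_unique[OF Q PCD(3,4)[OF PC(1)] immersion_compose[OF \<kappa> \<mu> order.refl] id that])
      then have "inj_on \<kappa> ?D"
        by (intro inj_on_inverseI[of _ \<mu>]) auto
      moreover have "W \<subseteq> Delta"
        using W(1) by (auto simp: OpenDisk_def PC_def)
      ultimately have "embeds Q ?D R Delta"
        using \<kappa> unfolding embeds_def embedding_def immersion_def by blast
      then show False using R by (simp add: \<B>_def)
    qed
  qed
  have D': "openin immersive_topology (M_imm Q ?D')"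
    using openin_M_imm_ClosedDisk[OF Q cball_ClosedDisk] r t by simp
  have "N \<inter> M_imm Q ?D' \<subseteq> M_emb P K"
  proof
    fix R assume R: "R \<in> N \<inter> M_imm Q ?D'"
    then have "R \<in> Mt" "immerses Q ?U R Delta"
      using immersion_restrict[of Q ?D' R Delta _ ?U] by (auto simp: M_imm_def immerses_def)
    then have "embeds Q ?D R Delta"
      using R N(3) by (auto simp: \<B>_def)
    then obtain \<mu> where "embedding Q ?D R Delta \<mu>" by (auto simp: embeds_def)
    then have "embedding P K R Delta (\<mu> \<circ> \<iota>)"
      by (rule embedding_compose[OF emb _ order.refl])
    then show "R \<in> M_emb P K"
      using \<open>R \<in> Mt\<close> by (auto simp: M_emb_def embeds_def)
  qed
  moreover have "Q \<in> M_imm Q ?D'"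
    using Q t unfolding M_imm_def immerses_def immersion_def
    by (auto simp: Delta_def intro!: exI[of _ id])
  ultimately show "\<exists>T. openin immersive_topology T \<and> Q \<in> T \<and> T \<subseteq> M_emb P K"
    using N D' by (intro exI[of _ "N \<inter> M_imm Q ?D'"]) auto
qed

text \<open>Compact path-connected sets through the basepoint are closed under binary union, so
  their immersions agree by uniqueness. Their interiors cover \<open>U\<close>, which makes the
  glued map continuous.\<close>

lemma immerses_if_compact_immerse:
  assumes Q: "Q \<in> Mt" and U: "U \<in> PC P" "open U"
    and imm: "\<And>K. K \<in> PC P \<Longrightarrow> compact K \<Longrightarrow> K \<subseteq> U \<Longrightarrow> immerses P K Q Delta"
  shows "immerses P U Q Delta"
proof -
  define \<K> where "\<K> = {K. K \<in> PC P \<and> compact K \<and> K \<subseteq> U}"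
  have "\<exists>\<iota>. \<forall>K\<in>\<K>. immersion P K Q Delta (\<iota> K)"
    using imm by (intro bchoice) (auto simp: immerses_def \<K>_def)
  then obtain \<iota> where \<iota>: "\<And>K. K \<in> \<K> \<Longrightarrow> immersion P K Q Delta (\<iota> K)"
    by blast
  have agree: "\<iota> K x = \<iota> L x" if K: "K \<in> \<K>" and L: "L \<in> \<K>" and x: "x \<in> K" "x \<in> L" for K L x
  proof -
    have 0: "0 \<in> K" "0 \<in> L" and conn: "connected K" "connected L"
      using K L PCD(3,4) by (auto simp: \<K>_def)
    have KL: "K \<union> L \<in> \<K>"
      using K L 0 path_connected_Un[of K L] by (auto simp: \<K>_def PC_def)
    have "\<iota> K x = \<iota> (K \<union> L) x"
      by (rule immersion_unique[OF Q conn(1) 0(1) \<iota>[OF K] immersion_restrict[OF \<iota>[OF KL]] x(1)]) simp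
    moreover have "\<iota> L x = \<iota> (K \<union> L) x"
      by (rule immersion_unique[OF Q conn(2) 0(2) \<iota>[OF L] immersion_restrict[OF \<iota>[OF KL]] x(2)]) simp
    ultimately show ?thesis by simp
  qed
  have "\<exists>K\<in>\<K>. x \<in> interior K" if x: "x \<in> U" for x
  proof -
    obtain d where d: "d > 0" "cball x d \<subseteq> U"
      using U(2) x open_contains_cball by blast
    obtain g where g: "path g" "path_image g \<subseteq> U" "pathstart g = 0" "pathfinish g = x"
      using PCD(2,4)[OF U(1)] x unfolding path_connected_def by blast
    \<comment> \<open>The path from the basepoint keeps the set in \<open>PC P\<close>, and the
      closed ball puts \<open>x\<close> in its interior.\<close>
    let ?K = "path_image g \<union> cball x d"
    have "path_connected ?K"
    proof (rule path_connected_Un)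
      show "path_connected (path_image g)" using g(1) by (rule path_connected_path_image)
      show "path_image g \<inter> cball x d \<noteq> {}"
        using g(4) d(1) pathfinish_in_path_image[of g] by auto
    qed (simp add: convex_imp_path_connected)
    moreover have "0 \<in> ?K"
      using g(3) pathstart_in_path_image[of g] by auto
    moreover have "?K \<subseteq> Delta"
      using g d PCD(1)[OF U(1)] by blast
    moreover have "compact ?K"
      using g(1) by (simp add: compact_Un compact_path_image)
    ultimately have "?K \<in> \<K>"
      using g d by (auto simp: \<K>_def PC_def)
    moreover have "x \<in> interior ?K"
      using d(1) interior_mono[of "cball x d" ?K] by auto
    ultimately show ?thesis by blast
  qed
  then obtain \<kappa> where \<kappa>: "\<And>x. x \<in> U \<Longrightarrow> \<kappa> x \<in> \<K>" "\<And>x. x \<in> U \<Longrightarrow> x \<in> interior (\<kappa> x)"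
    by metis
  define f where "f x = \<iota> (\<kappa> x) x" for x
  have f: "f y = \<iota> K y" if "K \<in> \<K>" "y \<in> K" for K y
  proof -
    have "y \<in> U" using that by (auto simp: \<K>_def)
    then show ?thesis
      unfolding f_def using agree[OF \<kappa>(1) that(1)] \<kappa>(2) interior_subset that(2) by blast
  qed
  have self: "x \<in> \<kappa> x" if "x \<in> U" for x
    using \<kappa>(2)[OF that] interior_subset by blast
  have "continuous_on U f"
  proof (rule continuous_at_imp_continuous_on, intro ballI)
    fix x assume x: "x \<in> U"
    have "continuous_on (interior (\<kappa> x)) (\<iota> (\<kappa> x))"
      using immersionD(1)[OF \<iota>[OF \<kappa>(1)[OF x]]] interior_subset by (rule continuous_on_subset)
    moreover have "f y = \<iota> (\<kappa> x) y" if "y \<in> interior (\<kappa> x)" for y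
      using f[OF \<kappa>(1)[OF x]] that interior_subset by blast
    ultimately have "continuous_on (interior (\<kappa> x)) f"
      by (simp cong: continuous_on_cong)
    then show "isCont f x"
      using \<kappa>(2)[OF x] continuous_on_eq_continuous_at open_interior by blast
  qed
  moreover have "f x \<in> Delta \<and> Q (f x) = P x" if "x \<in> U" for x
    unfolding f_def using immersionD(2,4)[OF \<iota>[OF \<kappa>(1)[OF that]]] self[OF that] by blast
  moreover have "f 0 = 0"
    unfolding f_def using immersionD(3)[OF \<iota>[OF \<kappa>(1)[OF PCD(4)[OF U(1)]]]] .
  ultimately show ?thesis
    unfolding immerses_def immersion_def by blast
qed

lemma openin_M_nimm:
  assumes P: "P \<in> Mt" and U: "U \<in> PC P" "open U"
  shows "openin immersive_topology (M_nimm P U)"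
proof (subst openin_subopen, intro ballI)
  fix Q assume "Q \<in> M_nimm P U"
  then have Q: "Q \<in> Mt" "\<not> immerses P U Q Delta"
    by (auto simp: M_nimm_def)
  then obtain K where K: "K \<in> PC P" "compact K" "K \<subseteq> U" "\<not> immerses P K Q Delta"
    using immerses_if_compact_immerse[OF Q(1) U] by blast
  obtain N where N: "openin immersive_topology N" "Q \<in> N" "N \<inter> {R \<in> Mt. immerses P U R Delta} = {}"
  proof (rule separating_nbhd[OF Q(1) P U K(1-3), of "{R \<in> Mt. immerses P U R Delta}"])
    show "\<not> embeds R W Q Delta" if "immerses P K R W" for R W
      using that K(4) immersion_compose[OF _ _ order.refl]
      unfolding immerses_def embeds_def embedding_def by blast
  qed auto
  then show "\<exists>T. openin immersive_topology T \<and> Q \<in> T \<and> T \<subseteq> M_nimm P U"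
    using Q(1) openin_Mt by (intro exI[of _ "N \<inter> Mt"]) (auto simp: M_nimm_def)
qed

text \<open>An immersion of \<open>U\<close> into \<open>Q\<close> identifying \<open>x\<close> and \<open>y\<close> forces every immersion of \<open>U\<close>
  into a surface near \<open>Q\<close> to identify them: the union of two paths from the basepoint to \<open>x\<close> and
  \<open>y\<close> is mapped into a disk that still immerses into that surface.\<close>
lemma openin_M_nemb:
  assumes P: "P \<in> Mt" and U: "U \<in> PC P" "open U"
  shows "openin immersive_topology (M_nemb P U)"
proof (subst openin_subopen, intro ballI)
  fix Q assume "Q \<in> M_nemb P U"
  then have Q: "Q \<in> Mt" "\<not> embeds P U Q Delta"
    by (auto simp: M_nemb_def)
  show "\<exists>T. openin immersive_topology T \<and> Q \<in> T \<and> T \<subseteq> M_nemb P U"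
  proof (cases "immerses P U Q Delta")
    case False
    moreover have "M_nimm P U \<subseteq> M_nemb P U"
      by (auto simp: M_nimm_def M_nemb_def immerses_def embeds_def embedding_def)
    ultimately show ?thesis
      using openin_M_nimm[OF P U] Q(1) by (intro exI[of _ "M_nimm P U"]) (auto simp: M_nimm_def)
  next
    case True
    then obtain \<iota> where \<iota>: "immersion P U Q Delta \<iota>" by (auto simp: immerses_def)
    then have "\<not> inj_on \<iota> U" using Q(2) by (auto simp: embeds_def embedding_def)
    then obtain x y where xy: "x \<in> U" "y \<in> U" "\<iota> x = \<iota> y" "x \<noteq> y" by (auto simp: inj_on_def)
    obtain g h where g: "path g" "path_image g \<subseteq> U" "pathstart g = 0" "pathfinish g = x"
      and h: "path h" "path_image h \<subseteq> U" "pathstart h = 0" "pathfinish h = y"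
      using PCD(2,4)[OF U(1)] xy(1,2) unfolding path_connected_def by metis
    define K where "K = path_image g \<union> path_image h"
    have K: "compact K" "K \<subseteq> U" "0 \<in> K" "x \<in> K" "y \<in> K"
      unfolding K_def using g h pathstart_in_path_image[of g] pathfinish_in_path_image[of g]
        pathfinish_in_path_image[of h] by (auto intro: compact_path_image)
    have conn: "connected K"
      unfolding K_def using g h pathstart_in_path_image[of g] pathstart_in_path_image[of h]
      by (intro connected_Un connected_path_image) auto
    obtain r where r: "0 < r" "r < 1" "immersion P K Q (cball 0 r) \<iota>"
      by (rule immersion_in_cball[OF K(1) immersion_restrict[OF \<iota> K(2)]])
    have "M_imm Q (cball 0 r) \<subseteq> M_nemb P U"
    proof
      fix R assume "R \<in> M_imm Q (cball 0 r)"
      then obtain \<mu> where R: "R \<in> Mt" and \<mu>: "immersion Q (cball 0 r) R Delta \<mu>"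
        by (auto simp: M_imm_def immerses_def)
      have "\<not> inj_on \<kappa> U" if \<kappa>: "immersion P U R Delta \<kappa>" for \<kappa>
      proof -
        have "\<kappa> z = (\<mu> \<circ> \<iota>) z" if "z \<in> K" for z
          by (rule immersion_unique[OF R conn K(3) immersion_restrict[OF \<kappa> K(2)]
                immersion_compose[OF r(3) \<mu> order.refl] that])
        then have "\<kappa> x = \<kappa> y" using K xy(3) by simp
        then show ?thesis using xy by (auto simp: inj_on_def)
      qed
      then show "R \<in> M_nemb P U"
        using R by (auto simp: M_nemb_def embeds_def embedding_def)
    qed
    moreover have "Q \<in> M_imm Q (cball 0 r)"
      using Q r unfolding M_imm_def immerses_def immersion_def
      by (auto simp: Delta_def intro!: exI[of _ id])
    ultimately show ?thesis
      using openin_M_imm_ClosedDisk[OF Q(1) cball_ClosedDisk[OF r(1,2)]] by blast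
  qed
qed

theorem mainTheorem3:
  assumes "P \<in> Mt"
  shows "(\<forall>K. K \<in> PC P \<and> compact K \<longrightarrow>
            openin immersive_topology (M_imm P K) \<and> openin immersive_topology (M_emb P K)) \<and>
         (\<forall>U. U \<in> PC P \<and> open U \<longrightarrow>
            openin immersive_topology (M_nimm P U) \<and> openin immersive_topology (M_nemb P U))"
  by (auto intro: openin_M_imm openin_M_emb openin_M_nimm[OF assms] openin_M_nemb[OF assms])

end
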